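(* For every integer $n\ge 1$, the matrix ring over dual numbers $M_n(\mathbb{D})$ is a clean ring.
   Context: $\mathbb{D}=\{a+b\epsilon \mid a,b\in\mathbb{R},\ \epsilon^2=0\}$ is the ring of dual numbers, and $M_n(\mathbb{D})$ is the ring of $n\times n$ matrices over $\mathbb{D}$. An element $a$ of a ring $R$ (associative with identity) is clean if $a=e+u$ with $e^2=e\in R$ and $u$ a unit of $R$. A ring is clean if every element of it is clean. *)

theory Defs
  imports Complex_Main "HOL-Algebra.Ring" "Jordan_Normal_Form.Matrix"
begin

(* Dual a b encodes a + b * epsilon; multiplication drops the epsilon^2 term. *)
datatype dual_num = Dual (std_part: real) (eps_part: real)

lemma dual_num_eq_iff: "x = y \<longleftrightarrow> std_part x = std_part y \<and> eps_part x = eps_part y"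
  by (auto intro: dual_num.expand)

instantiation dual_num :: comm_ring_1
begin

definition zero_dual_num :: dual_num where "0 = Dual 0 0"
definition one_dual_num :: dual_num where "1 = Dual 1 0"
definition plus_dual_num :: "dual_num \<Rightarrow> dual_num \<Rightarrow> dual_num" where
  "x + y = Dual (std_part x + std_part y) (eps_part x + eps_part y)"
definition minus_dual_num :: "dual_num \<Rightarrow> dual_num \<Rightarrow> dual_num" where
  "x - y = Dual (std_part x - std_part y) (eps_part x - eps_part y)"
definition uminus_dual_num :: "dual_num \<Rightarrow> dual_num" where
  "- x = Dual (- std_part x) (- eps_part x)"
definition times_dual_num :: "dual_num \<Rightarrow> dual_num \<Rightarrow> dual_num" where
  "x * y = Dual (std_part x * std_part y)
                (std_part x * eps_part y + eps_part x * std_part y)"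

instance
  by standard
     (auto simp: dual_num_eq_iff zero_dual_num_def one_dual_num_def plus_dual_num_def
        minus_dual_num_def uminus_dual_num_def times_dual_num_def algebra_simps)

end

instantiation dual_num :: real_algebra_1
begin

definition scaleR_dual_num :: "real \<Rightarrow> dual_num \<Rightarrow> dual_num" where
  "scaleR r x = Dual (r * std_part x) (r * eps_part x)"

instance
  by standard
     (auto simp: dual_num_eq_iff scaleR_dual_num_def plus_dual_num_def
        times_dual_num_def algebra_simps)

end

definition dual_eps :: dual_num where
  "dual_eps = Dual 0 1"

lemma dual_eps_squared: "dual_eps ^ 2 = 0"
  by (simp add: dual_eps_def power2_eq_square times_dual_num_def zero_dual_num_def)

lemma Dual_conv_eps: "Dual a b = of_real a + of_real b * dual_eps"
  by (simp add: of_real_def dual_eps_def scaleR_dual_num_def plus_dual_num_def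
      times_dual_num_def one_dual_num_def)

definition clean_element :: "('a, 'b) ring_scheme \<Rightarrow> 'a \<Rightarrow> bool" where
  "clean_element R a \<longleftrightarrow>
     (\<exists>e \<in> carrier R. \<exists>u \<in> Units R. e \<otimes>\<^bsub>R\<^esub> e = e \<and> a = e \<oplus>\<^bsub>R\<^esub> u)"

definition clean_ring :: "('a, 'b) ring_scheme \<Rightarrow> bool" where
  "clean_ring R \<longleftrightarrow> ring R \<and> (\<forall>a \<in> carrier R. clean_element R a)"

end

theory Submission
  imports Defs "Jordan_Normal_Form.Determinant"
begin

text \<open>Over a commutative local ring, every square matrix becomes invertible after subtracting a
  suitable diagonal matrix with entries 0 and 1, which is idempotent. Indeed, subtracting 1 from the
  last diagonal entry changes the determinant by the principal minor of the remaining indices; by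
  induction this minor can be made a unit, and if two elements of a local ring differ by a unit, one
  of them is a unit.\<close>

definition indicator_diag :: "nat \<Rightarrow> nat set \<Rightarrow> 'a::zero_neq_one mat" where
  "indicator_diag n S = mat n n (\<lambda>(i, j). if i = j \<and> i \<in> S then 1 else 0)"

lemma indicator_diag_carrier [simp]: "indicator_diag n S \<in> carrier_mat n n"
  and indicator_diag_dim [simp]:
    "dim_row (indicator_diag n S) = n" "dim_col (indicator_diag n S) = n"
  by (simp_all add: indicator_diag_def)

lemma indicator_diag_index [simp]:
  "i < n \<Longrightarrow> j < n \<Longrightarrow> indicator_diag n S $$ (i, j) = (if i = j \<and> i \<in> S then 1 else 0)"
  by (simp add: indicator_diag_def)

lemma indicator_diag_idem:
  "indicator_diag n S * indicator_diag n S = (indicator_diag n S :: 'a::comm_ring_1 mat)"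
proof (rule eq_matI)
  fix i j
  assume "i < dim_row (indicator_diag n S :: 'a mat)" "j < dim_col (indicator_diag n S :: 'a mat)"
  then have ij: "i < n" "j < n" by simp_all
  \<comment> \<open>Row \<open>i\<close> vanishes off the diagonal, so only \<open>k = i\<close>
    contributes; the summand is shaped so that the sum collapses.\<close>
  have "row (indicator_diag n S) i \<bullet> col (indicator_diag n S) j
      = (\<Sum>k<n. if k = i then (if i = j \<and> i \<in> S then 1 else 0) else (0::'a))"
    unfolding scalar_prod_def lessThan_atLeast0
    using ij by (intro sum.cong) auto
  then show "(indicator_diag n S * indicator_diag n S) $$ (i, j)
      = (indicator_diag n S :: 'a mat) $$ (i, j)"
    using ij by simp
qed simp_all

text \<open>Expand both determinants along row \<open>n\<close>: deleting that row removes the only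
  entry where the matrices may differ, so all cofactors agree.\<close>

lemma det_diff_last_entry:
  fixes A B :: "'a::comm_ring_1 mat"
  assumes A: "A \<in> carrier_mat (Suc n) (Suc n)" and B: "B \<in> carrier_mat (Suc n) (Suc n)"
    and eq: "\<And>i j. i < Suc n \<Longrightarrow> j < Suc n \<Longrightarrow> (i, j) \<noteq> (n, n) \<Longrightarrow> A $$ (i, j) = B $$ (i, j)"
  shows "det A - det B = (A $$ (n, n) - B $$ (n, n)) * det (mat_delete A n n)"
proof -
  have "mat_delete A n j = mat_delete B n j" for j
    using A B by (intro eq_matI) (auto simp: mat_delete_def eq)
  then have cof: "cofactor A n j = cofactor B n j" for j
    by (simp add: cofactor_def)
  have "det A - det B = (\<Sum>j<Suc n. (A $$ (n, j) - B $$ (n, j)) * cofactor A n j)"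
    unfolding laplace_expansion_row[OF A lessI] laplace_expansion_row[OF B lessI]
    by (simp add: cof sum_subtractf left_diff_distrib)
  also have "\<dots> = (A $$ (n, n) - B $$ (n, n)) * cofactor A n n"
    by (simp add: eq)
  finally show ?thesis
    \<comment> \<open>The sign is \<open>(-1) ^ (n + n)\<close>; rewriting the exponent as
      \<open>2 * n\<close> makes it 1.\<close>
    by (simp add: cofactor_def flip: mult_2)
qed

text \<open>Here \<open>loc\<close> expresses locality without ideals, with \<open>x dvd 1\<close>
  for units. The bound on \<open>S\<close> keeps the new index \<open>n\<close> outside
  \<open>S\<close> in the induction.\<close>

lemma ex_det_diff_indicator_diag_unit:
  fixes A :: "'a::comm_ring_1 mat"
  assumes loc: "\<And>x y :: 'a. x - y dvd 1 \<Longrightarrow> x dvd 1 \<or> y dvd 1"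
    and "A \<in> carrier_mat n n"
  shows "\<exists>S \<subseteq> {..<n}. det (A - indicator_diag n S) dvd 1"
  using assms(2)
proof (induction n arbitrary: A)
  case 0
  \<comment> \<open>The empty matrix has determinant 1.\<close>
  then show ?case by (simp add: det_def)
next
  case (Suc n)
  note A = Suc.prems
  have "mat_delete A n n \<in> carrier_mat n n"
    using A by (auto simp: mat_delete_def)
  from Suc.IH[OF this] obtain S where S: "S \<subseteq> {..<n}"
    and unit: "det (mat_delete A n n - indicator_diag n S) dvd 1"
    by blast
  \<comment> \<open>The two candidates differ by 1 in the last diagonal entry only, so their
    determinants differ by the minor that the induction hypothesis makes a unit.\<close>
  define B where "B = A - indicator_diag (Suc n) S"
  define C where "C = A - indicator_diag (Suc n) (insert n S)"
  have "B $$ (n, n) - C $$ (n, n) = 1"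
    using A S by (auto simp: B_def C_def)
  moreover have "mat_delete B n n = mat_delete A n n - indicator_diag n S"
    using A by (intro eq_matI) (auto simp: B_def mat_delete_def)
  moreover have "det B - det C = (B $$ (n, n) - C $$ (n, n)) * det (mat_delete B n n)"
    using A by (intro det_diff_last_entry) (auto simp: B_def C_def)
  ultimately have "det B dvd 1 \<or> det C dvd 1"
    using unit by (intro loc) simp
  moreover have "S \<subseteq> {..<Suc n}" "insert n S \<subseteq> {..<Suc n}"
    using S by auto
  ultimately show ?case
    unfolding B_def C_def by blast
qed

lemma Units_ring_mat_if_det_unit:
  fixes A :: "'a::comm_ring_1 mat"
  assumes A: "A \<in> carrier_mat n n" and "det A dvd 1"
  shows "A \<in> Units (ring_mat TYPE('a) n b)"
proof -
  obtain c where c: "c * det A = 1"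
    using assms(2) by (metis dvdE mult.commute)
  \<comment> \<open>The adjugate times the inverse of the determinant is a two-sided
    inverse.\<close>
  define B where "B = c \<cdot>\<^sub>m adj_mat A"
  have B: "B \<in> carrier_mat n n"
    using adj_mat(1)[OF A] by (simp add: B_def)
  have "A * B = 1\<^sub>m n" "B * A = 1\<^sub>m n"
    using adj_mat[OF A] A c by (auto simp: B_def mult_smult_distrib mult_smult_assoc_mat)
  with A B show ?thesis
    unfolding Units_def ring_mat_def by auto
qed

theorem clean_ring_mat:
  assumes loc: "\<And>x y :: 'a::comm_ring_1. x - y dvd 1 \<Longrightarrow> x dvd 1 \<or> y dvd 1"
  shows "clean_ring (ring_mat TYPE('a) n b)"
  unfolding clean_ring_def
proof (intro conjI ballI)
  show "ring (ring_mat TYPE('a) n b)"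
    by (rule ring_mat)
next
  fix A assume "A \<in> carrier (ring_mat TYPE('a) n b)"
  then have A: "A \<in> carrier_mat n n"
    by (simp add: ring_mat_simps)
  obtain S where S: "det (A - indicator_diag n S) dvd 1"
    using ex_det_diff_indicator_diag_unit[OF loc A] by blast
  have "A - indicator_diag n S \<in> Units (ring_mat TYPE('a) n b)"
    using A S by (intro Units_ring_mat_if_det_unit) auto
  moreover have "A = indicator_diag n S + (A - indicator_diag n S)"
    using A by (intro eq_matI) auto
  ultimately show "clean_element (ring_mat TYPE('a) n b) A"
    unfolding clean_element_def
    by (intro bexI[of _ "indicator_diag n S"] bexI[of _ "A - indicator_diag n S"])
      (auto simp: ring_mat_simps indicator_diag_idem)
qed

text \<open>This yields locality: the non-units are exactly the multiples of
  \<open>dual_eps\<close>, hence an ideal.\<close>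

lemma dual_num_dvd_1_iff: "x dvd (1 :: dual_num) \<longleftrightarrow> std_part x \<noteq> 0"
proof
  assume "x dvd 1"
  then show "std_part x \<noteq> 0"
    by (auto simp: dvd_def one_dual_num_def times_dual_num_def)
next
  assume "std_part x \<noteq> 0"
  \<comment> \<open>For \<open>x = Dual a b\<close>, the product with the conjugate
    \<open>Dual a (- b)\<close> is \<open>a\<^sup>2\<close>, so the inverse is the conjugate divided
    by \<open>a\<^sup>2\<close>.\<close>
  then have "1 = x * Dual (1 / std_part x) (- eps_part x / (std_part x)\<^sup>2)"
    by (simp add: one_dual_num_def times_dual_num_def power2_eq_square)
  then show "x dvd 1" ..
qed

theorem theorem4p1:
  fixes n :: nat
  assumes "n \<ge> 1"
  shows "clean_ring (ring_mat TYPE(dual_num) n ())"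
  \<comment> \<open>Locality reduces to this: two reals with nonzero difference are not both
    zero.\<close>
  by (rule clean_ring_mat) (auto simp: dual_num_dvd_1_iff minus_dual_num_def)

end
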